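(* Let $H$ be a monoid. The following are equivalent: (a) $H$ is a BF-monoid. (b) $\bigcap_{n\ge1}(H\setminus H^\times)^n = \emptyset$. (c) $H$ has a length function. In particular, if any of these conditions is satisfied, then $H$ is unit-cancellative.
   Context: Monoids are written multiplicatively and need not be commutative or cancellative; $H^\times$ is the set of units of $H$; $\mathbf N$ (resp. $\mathbf N^+$) is the set of non-negative (resp. positive) integers. For $S\subseteq H$ and $n \ge 1$, $S^n := \{s_1\cdots s_n : s_1,\dots,s_n\in S\}$. An element $a \in H$ is an atom if $a \notin H^\times$ and there are no $x,y \in H\setminus H^\times$ with $a = xy$; $\mathscr A(H)$ is the set of atoms. $\mathsf L_H(1_H) := \{0\}$, and for $x \ne 1_H$, $\mathsf L_H(x) := \{k \in \mathbf N^+ : x = a_1\cdots a_k \text{ for some } a_1,\dots,a_k \in \mathscr A(H)\}$. $H$ is a BF-monoid if $\mathsf L_H(x)$ is non-empty and finite for every $x \in H\setminus H^\times$. A length function on $H$ is a function $\lambda: H\to\mathbf N$ such that $\lambda(x)<\lambda(y)$ for all $x,y\in H$ such that $y = uxv$ for some $u,v\in H$ with $u\notin H^\times$ or $v\notin H^\times$. $H$ is unit-cancellative if, for $x,y\in H$, $xy = x$ or $yx = x$ implies $y \in H^\times$. *)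

theory Defs
  imports "HOL-Algebra.Group"
begin

text \<open>
  Possibly non-commutative, non-cancellative monoids. The notion \<open>irreducible\<close> of
  \<open>HOL-Algebra.Divisibility\<close> is built on one-sided divisibility and is therefore not used here.
\<close>

definition list_mult :: "('a, 'b) monoid_scheme \<Rightarrow> 'a list \<Rightarrow> 'a" where
  "list_mult H xs = foldr (\<otimes>\<^bsub>H\<^esub>) xs \<one>\<^bsub>H\<^esub>"

definition set_power :: "('a, 'b) monoid_scheme \<Rightarrow> 'a set \<Rightarrow> nat \<Rightarrow> 'a set" where
  "set_power H S n = {list_mult H xs | xs. length xs = n \<and> set xs \<subseteq> S}"

definition atoms :: "('a, 'b) monoid_scheme \<Rightarrow> 'a set" where
  "atoms H = {a \<in> carrier H. a \<notin> Units H \<and>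
     \<not> (\<exists>x \<in> carrier H - Units H. \<exists>y \<in> carrier H - Units H. a = x \<otimes>\<^bsub>H\<^esub> y)}"

definition length_set :: "('a, 'b) monoid_scheme \<Rightarrow> 'a \<Rightarrow> nat set" where
  "length_set H x =
     (if x = \<one>\<^bsub>H\<^esub> then {0}
      else {k. 1 \<le> k \<and> (\<exists>as. length as = k \<and> set as \<subseteq> atoms H \<and> x = list_mult H as)})"

definition bf_monoid :: "('a, 'b) monoid_scheme \<Rightarrow> bool" where
  "bf_monoid H \<longleftrightarrow>
     (\<forall>x \<in> carrier H - Units H. length_set H x \<noteq> {} \<and> finite (length_set H x))"

text \<open>Only the values of \<open>l\<close> on \<open>carrier H\<close> matter.\<close>

definition length_function :: "('a, 'b) monoid_scheme \<Rightarrow> ('a \<Rightarrow> nat) \<Rightarrow> bool" where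
  "length_function H l \<longleftrightarrow>
     (\<forall>x \<in> carrier H. \<forall>y \<in> carrier H.
        (\<exists>u \<in> carrier H. \<exists>v \<in> carrier H.
           y = u \<otimes>\<^bsub>H\<^esub> x \<otimes>\<^bsub>H\<^esub> v \<and> (u \<notin> Units H \<or> v \<notin> Units H))
        \<longrightarrow> l x < l y)"

definition unit_cancellative :: "('a, 'b) monoid_scheme \<Rightarrow> bool" where
  "unit_cancellative H \<longleftrightarrow>
     (\<forall>x \<in> carrier H. \<forall>y \<in> carrier H.
        x \<otimes>\<^bsub>H\<^esub> y = x \<or> y \<otimes>\<^bsub>H\<^esub> x = x \<longrightarrow> y \<in> Units H)"

end

theory Submission
  imports Defs
begin

text \<open>
  A length function bounds the number of non-unit factors in any factorization of \<open>x\<close> by \<open>l x\<close>,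
  which gives (c) \<open>\<Longrightarrow>\<close> (b); the non-units \<open>y\<close> and \<open>z\<close> in \<open>x = y z\<close> have smaller length than \<open>x\<close>, so
  \<open>x\<close> factors into atoms, which gives (c) \<open>\<Longrightarrow>\<close> (a). If (a) holds, refining factorizations
  of \<open>x\<close> into \<open>n\<close> non-units gives lengths at least \<open>n\<close>, whence (b). Finally, under (b) the
  monoid is unit-cancellative, because \<open>x e = x\<close> yields \<open>x = x e\<^sup>n\<close> for all \<open>n\<close>. Hence one-sided
  inverses are two-sided, the non-units form an ideal, and the largest \<open>n\<close> such that \<open>x\<close> is a
  product of \<open>n\<close> non-units is a length function.
\<close>

context monoid
begin

section \<open>Products of lists and powers of a set\<close>

lemma list_mult_Nil [simp]: "list_mult G [] = \<one>"
  by (simp add: list_mult_def)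

lemma list_mult_Cons [simp]: "list_mult G (x # xs) = x \<otimes> list_mult G xs"
  by (simp add: list_mult_def)

lemma list_mult_closed [simp]: "set xs \<subseteq> carrier G \<Longrightarrow> list_mult G xs \<in> carrier G"
  by (induction xs) auto

lemma list_mult_append:
  "set xs \<subseteq> carrier G \<Longrightarrow> set ys \<subseteq> carrier G \<Longrightarrow>
    list_mult G (xs @ ys) = list_mult G xs \<otimes> list_mult G ys"
  by (induction xs) (auto simp: m_assoc)

lemma set_power_closed: "S \<subseteq> carrier G \<Longrightarrow> set_power G S n \<subseteq> carrier G"
  by (auto simp: set_power_def)

lemma set_power_one:
  assumes "S \<subseteq> carrier G"
  shows "set_power G S 1 = S"
proof
  show "set_power G S 1 \<subseteq> S"
    using assms by (auto simp: set_power_def length_Suc_conv)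
  show "S \<subseteq> set_power G S 1"
  proof
    fix x assume "x \<in> S"
    with assms show "x \<in> set_power G S 1"
      unfolding set_power_def by (intro CollectI exI[of _ "[x]"]) auto
  qed
qed

lemma set_power_Suc: "set_power G S (Suc n) = {x \<otimes> y | x y. x \<in> S \<and> y \<in> set_power G S n}"
  (is "?L = ?R")
proof
  show "?L \<subseteq> ?R"
    by (fastforce simp: set_power_def length_Suc_conv)
  show "?R \<subseteq> ?L"
  proof
    fix z assume "z \<in> ?R"
    then obtain x xs where "z = x \<otimes> list_mult G xs" "x \<in> S" "length xs = n" "set xs \<subseteq> S"
      by (auto simp: set_power_def)
    then show "z \<in> ?L"
      unfolding set_power_def by (intro CollectI exI[of _ "x # xs"]) auto
  qed
qed

lemma atoms_subset_nonunits: "atoms G \<subseteq> carrier G - Units G"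
  by (auto simp: atoms_def)

section \<open>Length functions, factorizations into atoms and their refinement\<close>

lemma length_function_mult:
  assumes "length_function G l" "x \<in> carrier G" "u \<in> carrier G - Units G"
  shows "l x < l (u \<otimes> x)" "l x < l (x \<otimes> u)"
proof -
  have less: "l x < l (a \<otimes> x \<otimes> b)"
    if "a \<in> carrier G" "b \<in> carrier G" "a \<notin> Units G \<or> b \<notin> Units G" for a b
    using assms(1,2) that unfolding length_function_def by blast
  show "l x < l (u \<otimes> x)" using less[of u \<one>] assms by simp
  show "l x < l (x \<otimes> u)" using less[of \<one> u] assms by simp
qed

lemma length_le_length_function:
  assumes "length_function G l" "set xs \<subseteq> carrier G - Units G"
  shows "length xs \<le> l (list_mult G xs)"
  using assms(2)
proof (induction xs)
  case (Cons x xs)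
  then have "l (list_mult G xs) < l (x \<otimes> list_mult G xs)"
    by (intro length_function_mult(1)[OF assms(1)] list_mult_closed) auto
  with Cons show ?case by simp
qed simp

lemma length_function_imp_Inter_empty:
  assumes "length_function G l"
  shows "(\<Inter>n\<in>{1..}. set_power G (carrier G - Units G) n) = {}"
proof -
  \<comment> \<open>One factor more than the bound \<open>l x\<close> allows.\<close>
  have "x \<notin> set_power G (carrier G - Units G) (Suc (l x))" for x
    using length_le_length_function[OF assms] by (fastforce simp: set_power_def)
  then show ?thesis by fastforce
qed

lemma length_function_imp_atom_factorization:
  assumes "length_function G l" "x \<in> carrier G - Units G"
  shows "\<exists>as. set as \<subseteq> atoms G \<and> x = list_mult G as"
  using assms(2)
proof (induction "l x" arbitrary: x rule: less_induct)
  case less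
  show ?case
  proof (cases "x \<in> atoms G")
    case True
    with less.prems show ?thesis by (intro exI[of _ "[x]"]) auto
  next
    case False
    with less.prems obtain y z where yz: "y \<in> carrier G - Units G" "z \<in> carrier G - Units G"
      and x: "x = y \<otimes> z"
      unfolding atoms_def by blast
    have "l y < l x" "l z < l x"
      using length_function_mult[OF assms(1)] yz x by auto
    with less.hyps yz obtain as bs where ab: "set as \<subseteq> atoms G" "y = list_mult G as"
      "set bs \<subseteq> atoms G" "z = list_mult G bs"
      by metis
    then have "x = list_mult G (as @ bs)"
      using x atoms_subset_nonunits by (subst list_mult_append) auto
    with ab show ?thesis by (intro exI[of _ "as @ bs"]) auto
  qed
qed

text \<open>A non-unit differs from \<open>\<one>\<close>, which is the empty product, so neither
  the special value at \<open>\<one>\<close> nor the requirement \<open>1 \<le> k\<close> affects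
  its set of lengths.\<close>

lemma length_set_nonunit:
  assumes "x \<notin> Units G"
  shows "length_set G x = length ` {as. set as \<subseteq> atoms G \<and> x = list_mult G as}"
proof -
  have "x \<noteq> \<one>" using assms by auto
  moreover from this have "1 \<le> length as" if "x = list_mult G as" for as
    using that by (cases as) auto
  ultimately show ?thesis by (auto simp: length_set_def)
qed

lemma length_function_imp_bf_monoid:
  assumes "length_function G l"
  shows "bf_monoid G"
  unfolding bf_monoid_def
proof
  fix x assume x: "x \<in> carrier G - Units G"
  have "length_set G x \<subseteq> {..l x}"
    using length_le_length_function[OF assms] atoms_subset_nonunits x
    by (auto simp: length_set_nonunit)
  then have "finite (length_set G x)" by (rule finite_subset) simp
  with length_function_imp_atom_factorization[OF assms x] x
  show "length_set G x \<noteq> {} \<and> finite (length_set G x)"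
    by (auto simp: length_set_nonunit)
qed

text \<open>Each factor is replaced by one of its factorizations into atoms. That factorization is
  non-empty, because the empty product is a unit, so the number of factors cannot drop.\<close>

lemma bf_monoid_refine:
  assumes "bf_monoid G" "set xs \<subseteq> carrier G - Units G"
  shows "\<exists>as. set as \<subseteq> atoms G \<and> list_mult G as = list_mult G xs \<and> length xs \<le> length as"
  using assms(2)
proof (induction xs)
  case (Cons x xs)
  then obtain as where as: "set as \<subseteq> atoms G" "list_mult G as = list_mult G xs"
    "length xs \<le> length as"
    by auto
  from Cons.prems assms(1) have "length_set G x \<noteq> {}" "x \<notin> Units G"
    by (auto simp: bf_monoid_def)
  then obtain bs where bs: "set bs \<subseteq> atoms G" "x = list_mult G bs"
    by (auto simp: length_set_nonunit)
  with \<open>x \<notin> Units G\<close> have "bs \<noteq> []" by auto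
  then have "length (x # xs) \<le> length (bs @ as)"
    using as(3) by (cases bs) auto
  moreover have "list_mult G (bs @ as) = list_mult G (x # xs)"
    using as bs atoms_subset_nonunits by (subst list_mult_append) auto
  ultimately show ?case using as bs by (intro exI[of _ "bs @ as"]) auto
qed (auto intro!: exI[of _ "[]"])

lemma bf_monoid_imp_Inter_empty:
  assumes "bf_monoid G"
  shows "(\<Inter>n\<in>{1..}. set_power G (carrier G - Units G) n) = {}"
proof (rule ccontr)
  assume "\<not> ?thesis"
  then obtain x where x: "\<And>n. n \<ge> 1 \<Longrightarrow> x \<in> set_power G (carrier G - Units G) n"
    by auto
  from x[of 1] have nonunit: "x \<in> carrier G - Units G"
    using set_power_one[of "carrier G - Units G"] by auto
  have "\<exists>k \<in> length_set G x. n < k" for n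
  proof -
    obtain xs where "x = list_mult G xs" "length xs = Suc n" "set xs \<subseteq> carrier G - Units G"
      using x[of "Suc n"] by (auto simp: set_power_def)
    with bf_monoid_refine[OF assms, of xs] nonunit show ?thesis
      by (force simp: length_set_nonunit)
  qed
  then have "infinite (length_set G x)"
    by (meson finite_nat_set_iff_bounded_le leD)
  with assms nonunit show False by (auto simp: bf_monoid_def)
qed

text \<open>A non-unit \<open>y\<close> with \<open>x \<otimes> y = x\<close> or
  \<open>y \<otimes> x = x\<close> would give \<open>l x < l x\<close>.\<close>

lemma length_function_imp_unit_cancellative:
  assumes "length_function G l"
  shows "unit_cancellative G"
  unfolding unit_cancellative_def
  using length_function_mult[OF assms] by (metis DiffI less_irrefl)

section \<open>Units and non-units when the intersection is empty\<close>

lemma Inter_empty_right_unit: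
  assumes "(\<Inter>n\<in>{1..}. set_power G (carrier G - Units G) n) = {}"
    and "x \<in> carrier G" "e \<in> carrier G" "x \<otimes> e = x"
  shows "e \<in> Units G"
proof (rule ccontr)
  assume e: "e \<notin> Units G"
  \<comment> \<open>A unit \<open>x\<close> could be cancelled from
    \<open>x \<otimes> e = x\<close>. Hence \<open>x\<close> may itself serve as the first non-unit
    factor in the products below.\<close>
  have "x \<notin> Units G"
  proof
    assume "x \<in> Units G"
    moreover have "x \<otimes> e = x \<otimes> \<one>" using assms by simp
    ultimately have "e = \<one>" using assms by (metis Units_l_cancel one_closed)
    with e show False by simp
  qed
  have "x \<in> set_power G (carrier G - Units G) (Suc n)" for n
  proof -
    have absorb: "x \<otimes> list_mult G (replicate n e) = x"
    proof (induction n)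
      case (Suc n)
      have closed: "list_mult G (replicate n e) \<in> carrier G"
        using assms(3) by (intro list_mult_closed) auto
      have "x \<otimes> list_mult G (replicate (Suc n) e) = (x \<otimes> e) \<otimes> list_mult G (replicate n e)"
        using assms(2,3) closed by (simp add: m_assoc)
      with Suc assms(4) show ?case by simp
    qed (use assms(2) in simp)
    show ?thesis
      unfolding set_power_def using absorb \<open>x \<notin> Units G\<close> e assms(2,3)
      by (intro CollectI exI[of _ "x # replicate n e"]) auto
  qed
  then have "x \<in> set_power G (carrier G - Units G) n" if "n \<ge> 1" for n
    using that by (cases n) auto
  with assms(1) show False by auto
qed

text \<open>Since \<open>x\<close> absorbs \<open>y \<otimes> x\<close> on the right, this element
  is a unit; it is also idempotent, and an idempotent unit is \<open>\<one>\<close>.\<close>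

lemma Inter_empty_right_inverse:
  assumes "(\<Inter>n\<in>{1..}. set_power G (carrier G - Units G) n) = {}"
    and x: "x \<in> carrier G" and y: "y \<in> carrier G" and xy: "x \<otimes> y = \<one>"
  shows "y \<otimes> x = \<one>"
proof -
  have "x \<otimes> (y \<otimes> x) = x" using x y xy by (simp flip: m_assoc)
  with assms have unit: "y \<otimes> x \<in> Units G" by (intro Inter_empty_right_unit) auto
  have "(y \<otimes> x) \<otimes> (y \<otimes> x) = y \<otimes> ((x \<otimes> y) \<otimes> x)"
    using x y by (simp add: m_assoc)
  also have "\<dots> = (y \<otimes> x) \<otimes> \<one>" using x y xy by simp
  finally show ?thesis using unit x y by (metis Units_l_cancel m_closed one_closed)
qed

text \<open>The inverse of \<open>x \<otimes> y\<close> yields a right inverse of \<open>x\<close>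
  and a left inverse of \<open>y\<close>, and one-sided inverses are two-sided here. In other words,
  the non-units form a two-sided ideal.\<close>

lemma Inter_empty_Units_factors:
  assumes "(\<Inter>n\<in>{1..}. set_power G (carrier G - Units G) n) = {}"
    and x: "x \<in> carrier G" and y: "y \<in> carrier G" and xy: "x \<otimes> y \<in> Units G"
  shows "x \<in> Units G" "y \<in> Units G"
proof -
  let ?w = "inv (x \<otimes> y)"
  have w: "?w \<in> carrier G" using xy by simp
  have r: "x \<otimes> (y \<otimes> ?w) = \<one>" using x y xy w by (simp flip: m_assoc)
  have l: "(?w \<otimes> x) \<otimes> y = \<one>" using x y xy w by (simp add: m_assoc)
  from r Inter_empty_right_inverse[OF assms(1) _ _ r] x y w show "x \<in> Units G"
    unfolding Units_def by blast
  from l Inter_empty_right_inverse[OF assms(1) _ _ l] x y w show "y \<in> Units G"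
    unfolding Units_def by blast
qed

text \<open>The last factor absorbs \<open>v\<close> and stays a non-unit; the induction peels off
  the factors before it. The exponent is a successor so that there is a factor to absorb
  \<open>v\<close>.\<close>

lemma Inter_empty_set_power_mult_right:
  assumes "(\<Inter>n\<in>{1..}. set_power G (carrier G - Units G) n) = {}"
    and "x \<in> set_power G (carrier G - Units G) (Suc n)" "v \<in> carrier G"
  shows "x \<otimes> v \<in> set_power G (carrier G - Units G) (Suc n)"
  using assms(2)
proof (induction n arbitrary: x)
  case 0
  then have "x \<in> carrier G - Units G"
    using set_power_one[of "carrier G - Units G"] by auto
  with assms(3) Inter_empty_Units_factors(1)[OF assms(1)] have "x \<otimes> v \<in> carrier G - Units G"
    by blast
  then show ?case using set_power_one[of "carrier G - Units G"] by auto
next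
  case (Suc n)
  then obtain s z where sz: "x = s \<otimes> z" "s \<in> carrier G - Units G"
    "z \<in> set_power G (carrier G - Units G) (Suc n)"
    by (subst (asm) set_power_Suc) auto
  then have "x \<otimes> v = s \<otimes> (z \<otimes> v)"
    using set_power_closed[of "carrier G - Units G" "Suc n"] assms(3) by (auto simp: m_assoc)
  with sz Suc.IH show ?case by (subst set_power_Suc) auto
qed

text \<open>Here the first factor absorbs \<open>u\<close>, and \<open>set_power_Suc\<close> exposes
  it directly, so no induction is involved.\<close>

lemma Inter_empty_set_power_mult_left:
  assumes "(\<Inter>n\<in>{1..}. set_power G (carrier G - Units G) n) = {}"
    and "x \<in> set_power G (carrier G - Units G) (Suc n)" "u \<in> carrier G"
  shows "u \<otimes> x \<in> set_power G (carrier G - Units G) (Suc n)"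
proof -
  obtain s z where sz: "x = s \<otimes> z" "s \<in> carrier G - Units G"
    "z \<in> set_power G (carrier G - Units G) n"
    using assms(2) by (auto simp: set_power_Suc)
  then have "u \<otimes> x = (u \<otimes> s) \<otimes> z"
    using set_power_closed[of "carrier G - Units G" n] assms(3) by (auto simp: m_assoc)
  moreover have "u \<otimes> s \<in> carrier G - Units G"
    using sz(2) assms(3) Inter_empty_Units_factors(2)[OF assms(1)] by blast
  ultimately show ?thesis using sz(3) by (auto simp: set_power_Suc)
qed

text \<open>A non-unit among \<open>u\<close> and \<open>v\<close> becomes an additional factor,
  while the other element is absorbed into a neighbouring factor. This is the strict increase
  required of a length function.\<close>

lemma Inter_empty_set_power_mult_nonunit:
  assumes "(\<Inter>n\<in>{1..}. set_power G (carrier G - Units G) n) = {}"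
    and "x \<in> set_power G (carrier G - Units G) (Suc n)"
    and "u \<in> carrier G" "v \<in> carrier G" "u \<notin> Units G \<or> v \<notin> Units G"
  shows "u \<otimes> x \<otimes> v \<in> set_power G (carrier G - Units G) (Suc (Suc n))"
proof (cases "u \<in> Units G")
  case False
  then have "u \<otimes> x \<in> set_power G (carrier G - Units G) (Suc (Suc n))"
    using assms(2,3) by (subst set_power_Suc) auto
  then show ?thesis by (rule Inter_empty_set_power_mult_right[OF assms(1) _ assms(4)])
next
  case True
  with assms(5) have v: "v \<in> carrier G - Units G" using assms(4) by auto
  obtain xs where xs: "x = list_mult G xs" "length xs = Suc n" "set xs \<subseteq> carrier G - Units G"
    using assms(2) by (auto simp: set_power_def)
  have "x \<otimes> v = list_mult G (xs @ [v])"
    using xs v by (subst list_mult_append) auto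
  then have "x \<otimes> v \<in> set_power G (carrier G - Units G) (Suc (Suc n))"
    unfolding set_power_def using xs v by (intro CollectI exI[of _ "xs @ [v]"]) auto
  moreover have "x \<in> carrier G" using xs by (auto intro!: list_mult_closed)
  ultimately show ?thesis
    using Inter_empty_set_power_mult_left[OF assms(1) _ assms(3)] assms(3,4)
    by (simp add: m_assoc)
qed

text \<open>The first factor of a longer product is absorbed into the second. The chain starts at
  exponent 1, as the power with exponent 0 contains only \<open>\<one>\<close>.\<close>

lemma Inter_empty_set_power_antimono:
  assumes "(\<Inter>n\<in>{1..}. set_power G (carrier G - Units G) n) = {}" and "m \<le> n"
  shows "set_power G (carrier G - Units G) (Suc n) \<subseteq> set_power G (carrier G - Units G) (Suc m)"
proof (rule lift_Suc_antimono_le[OF _ assms(2)])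
  fix k
  show "set_power G (carrier G - Units G) (Suc (Suc k)) \<subseteq> set_power G (carrier G - Units G) (Suc k)"
    using Inter_empty_set_power_mult_left[OF assms(1)]
    by (subst set_power_Suc) auto
qed

section \<open>Construction of a length function\<close>

lemma Inter_empty_imp_length_function:
  assumes empty: "(\<Inter>n\<in>{1..}. set_power G (carrier G - Units G) n) = {}"
  shows "\<exists>l. length_function G l"
proof -
  \<comment> \<open>The inserted 0 keeps \<open>L x\<close> non-empty when \<open>x\<close> is a
    unit, so that \<open>Max\<close> is meaningful and gives units the length 0.\<close>
  define L where "L x = insert 0 {n. n \<ge> 1 \<and> x \<in> set_power G (carrier G - Units G) n}" for x
  have finite_L: "finite (L x)" for x
  proof -
    \<comment> \<open>Some power misses \<open>x\<close>; as the powers decrease, so do all later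
      ones, which bounds \<open>L x\<close>.\<close>
    obtain m where m: "x \<notin> set_power G (carrier G - Units G) (Suc m)"
      using empty by (metis (lifting) INT_I One_nat_def Suc_le_D atLeast_iff emptyE)
    have "n \<le> m" if "n \<ge> 1" "x \<in> set_power G (carrier G - Units G) n" for n
      using that m Inter_empty_set_power_antimono[OF empty, of m "n - 1"] by (cases n) force+
    then have "L x \<subseteq> {..m}" by (auto simp: L_def)
    then show ?thesis by (rule finite_subset) simp
  qed
  have "Max (L x) < Max (L (u \<otimes> x \<otimes> v))"
    if x: "x \<in> carrier G" and uv: "u \<in> carrier G" "v \<in> carrier G" "u \<notin> Units G \<or> v \<notin> Units G"
    for x u v
  proof -
    have "Max (L x) \<in> L x" using finite_L by (intro Max_in) (auto simp: L_def)
    then have "Suc (Max (L x)) \<in> L (u \<otimes> x \<otimes> v)"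
    proof (cases "Max (L x)")
      case 0
      \<comment> \<open>Length 0 belongs to a unit \<open>x\<close>, which lies in no power to be
        extended; it suffices that the product is a non-unit, because then 1 is among its
        lengths.\<close>
      have "u \<otimes> x \<otimes> v \<in> carrier G - Units G"
        using Inter_empty_Units_factors[OF empty] x uv by (metis DiffI m_closed)
      with 0 show ?thesis using set_power_one[of "carrier G - Units G"] by (auto simp: L_def)
    next
      case (Suc n)
      with \<open>Max (L x) \<in> L x\<close> have "x \<in> set_power G (carrier G - Units G) (Suc n)"
        by (simp add: L_def)
      with Suc show ?thesis
        using Inter_empty_set_power_mult_nonunit[OF empty _ uv] by (simp add: L_def)
    qed
    with finite_L show ?thesis by (meson Max_ge Suc_le_lessD)
  qed
  then show ?thesis
    unfolding length_function_def by (intro exI[of _ "\<lambda>x. Max (L x)"]) blast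
qed

end

theorem corollary2p29:
  fixes H :: "('a, 'b) monoid_scheme"
  assumes "monoid H"
  shows "(bf_monoid H \<longleftrightarrow> (\<Inter>n\<in>{1..}. set_power H (carrier H - Units H) n) = {}) \<and>
         ((\<Inter>n\<in>{1..}. set_power H (carrier H - Units H) n) = {} \<longleftrightarrow> (\<exists>l. length_function H l)) \<and>
         (bf_monoid H \<or> (\<Inter>n\<in>{1..}. set_power H (carrier H - Units H) n) = {} \<or>
            (\<exists>l. length_function H l) \<longrightarrow> unit_cancellative H)"
proof -
  interpret monoid H by (rule assms)
  \<comment> \<open>The cycle (a) to (b) to (c) to (a) gives the equivalences; each condition thus
    provides a length function, from which unit-cancellativity follows.\<close>
  show ?thesis
    using bf_monoid_imp_Inter_empty Inter_empty_imp_length_function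
      length_function_imp_bf_monoid length_function_imp_Inter_empty
      length_function_imp_unit_cancellative
    by blast
qed

end
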